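(* Let $n$ be a positive integer and let $a\in k_n$ be a generic element. Then the representation $\varphi_a:k^n\oplus k^n\to k^n$ of $\Lambda_1$, whose matrix is $[\alpha(a)\ \ \mathrm{id}_n]$, is a regular simple representation.
   Context: $k=\mathbb{C}(\!(\varepsilon)\!)$, $k_n=\mathbb{C}(\!(\varepsilon^{1/n})\!)$ and $\sigma_n$ is the $k$-automorphism of $k_n$ with $\sigma_n(\varepsilon^{j/n})=\zeta_n^j\varepsilon^{j/n}$, $\zeta_n=e^{2\pi i/n}$. An element $a\in k_n$ is generic if its orbit under $\langle\sigma_n\rangle$ has exactly $n$ elements. $\alpha_n\in\mathrm{Mat}_{n\times n}(k)$ is the matrix with $(\alpha_n)_{ij}=\delta_{i+1,j}$ for $i<n$ and $(\alpha_n)_{nj}=\delta_{1,j}\varepsilon$ (so $\alpha_1=\varepsilon$). The map $\alpha:k_n\to\mathrm{Mat}_{n\times n}(k)$ is the $k$-algebra homomorphism sending $\varepsilon^{1/n}$ to $\alpha_n$, i.e. $\alpha(\sum_{i=0}^{n-1}x_i\varepsilon^{i/n})=\sum_ix_i\alpha_n^i$ for $x_i\in k$. $\Lambda_1=\begin{bmatrix}k&k^2\\0&k\end{bmatrix}$ is the path algebra of the 2-Kronecker quiver over $k$; a representation is a $k$-linear map $\varphi:k^{p'}\oplus k^{p'}\to k^p$ with matrix $[A\ B]$, i.e. a pair of $p\times p'$ matrices over $k$; its dimension vector is $(p',p)$; morphisms from $[A\ B]$ to $[A'\ B']$ are pairs $(P,Q)$ of matrices over $k$ with $QA=A'P$,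 $QB=B'P$. It is regular simple if its dimension vector is $(p,p)$ for some $p\ge1$ and its endomorphism ring is a division algebra. *)

theory Defs
  imports
    Complex_Main
    "HOL-Computational_Algebra.Formal_Laurent_Series"
    "Jordan_Normal_Form.VS_Connect"
begin

text \<open>
  Both k = C((eps)) and k_n = C((eps^{1/n})) are carried by the type of formal Laurent series;
  the indeterminate \<open>fls_X\<close> stands for eps in k and for eps^{1/n} in k_n. The inclusion of k
  in k_n is therefore the substitution of \<open>fls_X ^ n\<close> for \<open>fls_X\<close>, not the identity map.
\<close>

type_synonym laurent = "complex fls"

definition incl :: "nat \<Rightarrow> laurent \<Rightarrow> laurent" where
  "incl n x = fls_compose_power x n"

definition zeta :: "nat \<Rightarrow> complex" where
  "zeta n = exp (2 * of_real pi * \<i> / of_nat n)"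

text \<open>The substitution of \<open>zeta n * fls_X\<close> for \<open>fls_X\<close> in k_n.\<close>

definition sigma :: "nat \<Rightarrow> laurent \<Rightarrow> laurent" where
  "sigma n a = fls_compose_fps a (fps_const (zeta n) * fps_X)"

lemma zeta_nonzero [simp]: "zeta n \<noteq> 0"
  by (simp add: zeta_def)

lemma zeta_power: "n > 0 \<Longrightarrow> zeta n ^ n = 1"
  by (simp add: zeta_def flip: exp_of_nat_mult)

lemma sigma_nth: "fls_nth (sigma n a) j = zeta n powi j * fls_nth a j"
  by (simp add: sigma_def fls_nth_fls_compose_fps_linear)

lemma sigma_add: "sigma n (a + b) = sigma n a + sigma n b"
  by (intro fls_eqI) (simp add: sigma_nth algebra_simps)

lemma sigma_mult: "sigma n (a * b) = sigma n a * sigma n b"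
  unfolding sigma_def by (intro fls_compose_fps_mult) auto

lemma sigma_X_power: "sigma n (fls_X ^ j) = fls_const (zeta n ^ j) * fls_X ^ j"
  by (intro fls_eqI) (auto simp: sigma_nth)

lemma sigma_incl:
  assumes "n > 0"
  shows "sigma n (incl n x) = incl n x"
  using assms
  by (intro fls_eqI)
     (auto simp: sigma_nth incl_def fls_nth_compose_power power_int_mult zeta_power)

lemma sigma_order:
  assumes "n > 0"
  shows "(sigma n ^^ n) a = a"
proof -
  have "fls_nth ((sigma n ^^ m) a) j = (zeta n ^ m) powi j * fls_nth a j" for m j
    by (induction m) (auto simp: sigma_nth power_int_mult_distrib)
  then show ?thesis
    by (intro fls_eqI) (simp add: zeta_power assms)
qed

text \<open>
  Since \<open>sigma n ^^ n\<close> is the identity, natural powers exhaust the group generated by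
  \<open>sigma n\<close>.
\<close>

definition sigma_orbit :: "nat \<Rightarrow> laurent \<Rightarrow> laurent set" where
  "sigma_orbit n a = {(sigma n ^^ m) a | m. True}"

definition generic :: "nat \<Rightarrow> laurent \<Rightarrow> bool" where
  "generic n a \<longleftrightarrow> finite (sigma_orbit n a) \<and> card (sigma_orbit n a) = n"

text \<open>
  The coordinates x_i of an element of k_n with respect to the k-basis
  \<open>1, fls_X, \<dots>, fls_X ^ (n - 1)\<close>; the next lemmas are existence and uniqueness of the expansion.
\<close>

definition coord :: "nat \<Rightarrow> nat \<Rightarrow> laurent \<Rightarrow> laurent" where
  "coord n i a = Abs_fls (\<lambda>m. fls_nth a (int n * m + int i))"

lemma coord_nth:
  assumes "n > 0" "i < n"
  shows "fls_nth (coord n i a) m = fls_nth a (int n * m + int i)"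
proof -
  have "fls_nth a (int n * m + int i) = 0" if "m < - \<bar>fls_subdegree a\<bar> - 1" for m
  proof (rule fls_eq0_below_subdegree)
    have "int n * (m + 1) \<le> 1 * (m + 1)"
      using assms that by (intro mult_right_mono_neg) auto
    then show "int n * m + int i < fls_subdegree a"
      using assms that by (simp add: algebra_simps)
  qed
  then show ?thesis
    unfolding coord_def by (intro nth_Abs_fls_lower_bound) blast
qed

lemma incl_sum_nth:
  assumes "n > 0" "i < n"
  shows "fls_nth (\<Sum>j<n. incl n (x j) * fls_X ^ j) (int n * m + int i) = fls_nth (x i) m"
proof -
  have *: "fls_nth (incl n (x j) * fls_X ^ j) (int n * m + int i) = (if j = i then fls_nth (x i) m else 0)"
    if "j < n" for j
  proof -
    have "int n dvd (int n * m + int i - int j) \<longleftrightarrow> int n dvd int i - int j"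
      by (metis add_diff_eq dvd_add_right_iff dvd_triv_left)
    also have "\<dots> \<longleftrightarrow> j = i"
      using assms that zdvd_imp_le[of "int n" "int i - int j"] zdvd_imp_le[of "int n" "int j - int i"]
      by (cases i j rule: linorder_cases) (auto simp: dvd_diff_commute)
    finally show ?thesis
      using assms by (auto simp: incl_def fls_nth_compose_power fls_X_power_times_conv_shift)
  qed
  show ?thesis
    using assms by (simp add: fls_nth_sum * sum.delta)
qed

lemma coord_expansion:
  assumes "n > 0"
  shows "a = (\<Sum>i<n. incl n (coord n i a) * fls_X ^ i)"
proof (rule fls_eqI)
  fix j
  define m i where "m = j div int n" and "i = nat (j mod int n)"
  have "i < n" and j: "j = int n * m + int i"
    using assms by (auto simp: m_def i_def nat_less_iff)
  then show "fls_nth a j = fls_nth (\<Sum>i<n. incl n (coord n i a) * fls_X ^ i) j"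
    using assms by (simp add: incl_sum_nth coord_nth)
qed

lemma coord_unique:
  assumes "n > 0" "i < n" "a = (\<Sum>j<n. incl n (x j) * fls_X ^ j)"
  shows "coord n i a = x i"
  using assms by (intro fls_eqI) (simp add: coord_nth incl_sum_nth)

text \<open>Matrix indices start at 0, so row n of the mathematical matrix is row \<open>n - 1\<close> here.\<close>

definition alpha_gen :: "nat \<Rightarrow> laurent mat" where
  "alpha_gen n = mat n n (\<lambda>(i, j).
     if i < n - 1 then (if j = i + 1 then 1 else 0)
     else (if j = 0 then fls_X else 0))"

text \<open>The sum of the matrices \<open>coord n i a \<cdot>\<^sub>m alpha_gen n ^\<^sub>m i\<close>, written entrywise.\<close>

definition alpha :: "nat \<Rightarrow> laurent \<Rightarrow> laurent mat" where
  "alpha n a = mat n n (\<lambda>(r, c). \<Sum>i<n. (coord n i a \<cdot>\<^sub>m (alpha_gen n ^\<^sub>m i)) $$ (r, c))"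

text \<open>
  A representation of the 2-Kronecker quiver is a pair of matrices of the same shape, the two
  blocks of the matrix [A B]; its dimension vector lists the source before the target.
\<close>

type_synonym 'a kronecker_rep = "'a mat \<times> 'a mat"

definition is_kronecker_rep :: "'a kronecker_rep \<Rightarrow> bool" where
  "is_kronecker_rep R \<longleftrightarrow> dim_row (fst R) = dim_row (snd R) \<and> dim_col (fst R) = dim_col (snd R)"

definition dimension_vector :: "'a kronecker_rep \<Rightarrow> nat \<times> nat" where
  "dimension_vector R = (dim_col (fst R), dim_row (fst R))"

definition kronecker_hom ::
  "'a :: field kronecker_rep \<Rightarrow> 'a kronecker_rep \<Rightarrow> ('a mat \<times> 'a mat) set" where
  "kronecker_hom R R' = {(P, Q).
     P \<in> carrier_mat (fst (dimension_vector R')) (fst (dimension_vector R)) \<and>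
     Q \<in> carrier_mat (snd (dimension_vector R')) (snd (dimension_vector R)) \<and>
     Q * fst R = fst R' * P \<and> Q * snd R = snd R' * P}"

definition kronecker_End ::
  "'a :: field kronecker_rep \<Rightarrow> ('a, 'a mat \<times> 'a mat) module" where
  "kronecker_End R =
    \<lparr> carrier = kronecker_hom R R,
      mult = (\<lambda>(P, Q) (P', Q'). (P * P', Q * Q')),
      one = (1\<^sub>m (fst (dimension_vector R)), 1\<^sub>m (snd (dimension_vector R))),
      zero = (0\<^sub>m (fst (dimension_vector R)) (fst (dimension_vector R)),
              0\<^sub>m (snd (dimension_vector R)) (snd (dimension_vector R))),
      add = (\<lambda>(P, Q) (P', Q'). (P + P', Q + Q')),
      smult = (\<lambda>c (P, Q). (c \<cdot>\<^sub>m P, c \<cdot>\<^sub>m Q)) \<rparr>"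

text \<open>The locale \<open>algebra\<close> of the library covers commutative algebras only.\<close>

definition division_algebra :: "('k, 'm) ring_scheme \<Rightarrow> ('k, 'd, 'n) module_scheme \<Rightarrow> bool" where
  "division_algebra K D \<longleftrightarrow>
     Ring.field K \<and> Module.module K D \<and> Ring.ring D \<and>
     (\<forall>c \<in> carrier K. \<forall>x \<in> carrier D. \<forall>y \<in> carrier D.
        (c \<odot>\<^bsub>D\<^esub> x) \<otimes>\<^bsub>D\<^esub> y = c \<odot>\<^bsub>D\<^esub> (x \<otimes>\<^bsub>D\<^esub> y) \<and>
        x \<otimes>\<^bsub>D\<^esub> (c \<odot>\<^bsub>D\<^esub> y) = c \<odot>\<^bsub>D\<^esub> (x \<otimes>\<^bsub>D\<^esub> y)) \<and>
     \<one>\<^bsub>D\<^esub> \<noteq> \<zero>\<^bsub>D\<^esub> \<and> Units D = carrier D - {\<zero>\<^bsub>D\<^esub>}"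

definition regular_simple :: "'a :: field kronecker_rep \<Rightarrow> bool" where
  "regular_simple R \<longleftrightarrow>
     is_kronecker_rep R \<and> (\<exists>p \<ge> 1. dimension_vector R = (p, p)) \<and>
     division_algebra (class_ring :: 'a ring) (kronecker_End R)"

definition phi :: "nat \<Rightarrow> laurent \<Rightarrow> laurent kronecker_rep" where
  "phi n a = (alpha n a, 1\<^sub>m n)"

end

theory Submission
  imports Defs
begin

text \<open>
  An endomorphism of \<open>(A, 1)\<close> is a pair \<open>(P, P)\<close> with \<open>P\<close> commuting with \<open>A\<close>, so the endomorphism
  ring of \<open>phi n a\<close> is the commutant of \<open>alpha n a\<close>, and what has to be shown is that each nonzero
  member \<open>P\<close> of this commutant is invertible (\<open>regular_simple_commutant\<close>).

  If every nonzero vector is cyclic for a matrix \<open>A\<close>, then a singular \<open>P\<close> in the commutant is zero: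
  \<open>P\<close> kills some \<open>v \<noteq> 0\<close>, hence it kills \<open>v, A v, A\<^sup>2 v, \<dots>\<close>, and these span the whole space
  (\<open>commutant_det_nonzero\<close>).

  Every nonzero vector is cyclic for \<open>alpha n a\<close>. Identify k^n with the field k_n by a suitable
  k-linear bijection \<open>element\<close>; then \<open>alpha n a\<close> becomes multiplication by \<open>a\<close>
  (\<open>element_alpha\<close>). A linear relation between the vectors \<open>A\<^sup>j v\<close> with \<open>j < n\<close> becomes a relation
  between the products of \<open>a ^ j\<close> with the fixed nonzero element \<open>element n v\<close>, which may be
  cancelled. Finally \<open>1, a, \<dots>, a ^ (n - 1)\<close> are linearly independent over k, because a polynomial
  over k that vanishes at \<open>a\<close> vanishes at the whole orbit of \<open>a\<close>, which for generic \<open>a\<close> has \<open>n\<close>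
  elements (\<open>generic_powers_independent\<close>).
\<close>

(* The symbol $ is kept for the entries of vectors. *)
no_notation fps_nth (infixl "$" 75)

section \<open>Endomorphism algebras of Kronecker representations\<close>

lemma kronecker_End_ring:
  fixes R :: "'a :: field kronecker_rep"
  assumes "is_kronecker_rep R"
  shows "abelian_group (kronecker_End R)" "Ring.ring (kronecker_End R)"
proof -
  obtain A B where R: "R = (A, B)" by (cases R)
  define m p where "m = dim_row A" and "p = dim_col A"
  have A: "A \<in> carrier_mat m p" and B: "B \<in> carrier_mat m p"
    using assms by (auto simp: R m_def p_def is_kronecker_rep_def)
  let ?C = "kronecker_hom R R"
  have C: "(P, Q) \<in> ?C \<longleftrightarrow> P \<in> carrier_mat p p \<and> Q \<in> carrier_mat m m \<and> Q * A = A * P \<and> Q * B = B * P"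
    for P Q
    by (simp add: kronecker_hom_def dimension_vector_def R m_def p_def)
  have add: "(P + P', Q + Q') \<in> ?C" if "(P, Q) \<in> ?C" "(P', Q') \<in> ?C" for P Q P' Q'
    using that A B
    by (auto simp: C add_mult_distrib_mat[OF _ _ A] add_mult_distrib_mat[OF _ _ B]
        mult_add_distrib_mat[OF A] mult_add_distrib_mat[OF B])
  have mult: "(P * P', Q * Q') \<in> ?C" if "(P, Q) \<in> ?C" "(P', Q') \<in> ?C" for P Q P' Q'
  proof -
    have comp: "Q * Q' * M = M * (P * P')"
      if "M \<in> carrier_mat m p" "Q * M = M * P" "Q' * M = M * P'"
        "P \<in> carrier_mat p p" "P' \<in> carrier_mat p p" "Q \<in> carrier_mat m m" "Q' \<in> carrier_mat m m"
      for M
      using assoc_mult_mat[OF that(6,7,1)] assoc_mult_mat[OF that(6,1,5)] assoc_mult_mat[OF that(1,4,5)]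
      by (simp add: that(2,3))
    show ?thesis
      using that comp[OF A] comp[OF B] by (auto simp: C)
  qed
  have neg: "(- P, - Q) \<in> ?C" if "(P, Q) \<in> ?C" for P Q
    using that A B by (auto simp: C)
  have zero: "(0\<^sub>m p p, 0\<^sub>m m m) \<in> ?C" and one: "(1\<^sub>m p, 1\<^sub>m m) \<in> ?C"
    using A B by (auto simp: C)
  have sel: "fst (dimension_vector R) = p" "snd (dimension_vector R) = m"
    by (simp_all add: dimension_vector_def R m_def p_def)
  show group: "abelian_group (kronecker_End R)"
  proof (rule abelian_groupI, goal_cases)
    case (6 x)
    then obtain P Q where x: "x = (P, Q)" "(P, Q) \<in> ?C"
      by (cases x) (auto simp: kronecker_End_def)
    then have "P \<in> carrier_mat p p" "Q \<in> carrier_mat m m"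
      by (auto simp: C)
    then show ?case
      using neg[OF x(2)] x(1)
      by (intro bexI[of _ "(- P, - Q)"]) (auto simp: kronecker_End_def sel)
  next
    case (3 x y z)
    then show ?case
      by (cases x; cases y; cases z)
         (auto simp: kronecker_End_def sel C intro!: assoc_add_mat)
  next
    case (4 x y)
    then show ?case
      by (cases x; cases y) (auto simp: kronecker_End_def sel C intro!: comm_add_mat)
  qed (auto simp: kronecker_End_def sel add zero, auto simp: C)
  show "Ring.ring (kronecker_End R)"
  proof (rule ringI[OF group], goal_cases)
    case 1
    show ?case
    proof (rule monoidI, goal_cases)
      case (3 x y z)
      then show ?case
        by (cases x; cases y; cases z)
           (auto simp: kronecker_End_def sel C intro!: assoc_mult_mat)
    qed (auto simp: kronecker_End_def sel one mult, auto simp: C)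
  next
    case (2 x y z)
    then show ?case
      by (cases x; cases y; cases z)
         (auto simp: kronecker_End_def sel C intro!: add_mult_distrib_mat)
  next
    case (3 x y z)
    then show ?case
      by (cases x; cases y; cases z)
         (auto simp: kronecker_End_def sel C intro!: mult_add_distrib_mat)
  qed
qed

lemma kronecker_End_module:
  fixes R :: "'a :: field kronecker_rep"
  assumes "is_kronecker_rep R"
  shows "Module.module (class_ring :: 'a ring) (kronecker_End R)"
proof -
  have scale: "(c \<cdot>\<^sub>m Q) * M = M * (c \<cdot>\<^sub>m P)"
    if "Q * M = M * P" "Q \<in> carrier_mat m m" "M \<in> carrier_mat m p" "P \<in> carrier_mat p p"
    for c :: 'a and M P Q m p
    using that by (simp add: mult_smult_distrib[of M m p P p] mult_smult_assoc_mat[of Q m m M p])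
  have "(c \<cdot>\<^sub>m P, c \<cdot>\<^sub>m Q) \<in> kronecker_hom R R" if "(P, Q) \<in> kronecker_hom R R" for c P Q
    using that assms
    by (auto simp: kronecker_hom_def is_kronecker_rep_def dimension_vector_def intro!: scale)
  then show ?thesis
    by (intro moduleI class_cring.cring_axioms kronecker_End_ring(1) assms)
       (auto simp: kronecker_End_def kronecker_hom_def add_smult_distrib_right_mat
         add_smult_distrib_left_mat)
qed

lemma det_nonzero_inverse:
  fixes M :: "'a :: field mat"
  assumes "M \<in> carrier_mat n n" "det M \<noteq> 0"
  obtains N where "N \<in> carrier_mat n n" "N * M = 1\<^sub>m n" "M * N = 1\<^sub>m n"
  using det_non_zero_imp_unit[OF assms, of "()"] by (auto simp: Units_def ring_mat_def)

text \<open>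
  The second matrix being the identity forces the two components of an endomorphism to agree. The
  determinant condition produces an inverse matrix, and this inverse commutes with \<open>A\<close> as well, so
  it is an inverse in the endomorphism ring.
\<close>

lemma regular_simple_commutant:
  fixes A :: "'a :: field mat"
  assumes A: "A \<in> carrier_mat n n" and "n > 0"
    and comm: "\<And>P. P \<in> carrier_mat n n \<Longrightarrow> P * A = A * P \<Longrightarrow> P \<noteq> 0\<^sub>m n n \<Longrightarrow> det P \<noteq> 0"
  shows "regular_simple (A, 1\<^sub>m n)"
proof -
  let ?R = "(A, 1\<^sub>m n)" and ?E = "kronecker_End (A, 1\<^sub>m n)"
  have rep: "is_kronecker_rep ?R" and dim: "dimension_vector ?R = (n, n)"
    using A by (auto simp: is_kronecker_rep_def dimension_vector_def)
  interpret E: ring ?E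
    by (rule kronecker_End_ring(2)[OF rep])
  have hom: "x \<in> carrier ?E \<longleftrightarrow> (\<exists>P \<in> carrier_mat n n. P * A = A * P \<and> x = (P, P))" for x
    by (cases x) (auto simp: kronecker_End_def kronecker_hom_def dim)
  have zero: "\<zero>\<^bsub>?E\<^esub> = (0\<^sub>m n n, 0\<^sub>m n n)" and one: "\<one>\<^bsub>?E\<^esub> = (1\<^sub>m n, 1\<^sub>m n)"
    and mult: "(P, P) \<otimes>\<^bsub>?E\<^esub> (P', P') = (P * P', P * P')" for P P' :: "'a mat"
    by (simp_all add: kronecker_End_def dim)
  have "0\<^sub>m n n $$ (0, 0) \<noteq> (1\<^sub>m n $$ (0, 0) :: 'a)"
    using \<open>n > 0\<close> by simp
  then have nontrivial: "\<one>\<^bsub>?E\<^esub> \<noteq> \<zero>\<^bsub>?E\<^esub>"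
    unfolding zero one by (metis prod.inject)
  have "x \<in> Units ?E" if x: "x \<in> carrier ?E" "x \<noteq> \<zero>\<^bsub>?E\<^esub>" for x
  proof -
    obtain P where P: "P \<in> carrier_mat n n" "P * A = A * P" "x = (P, P)"
      using x hom by blast
    then have "det P \<noteq> 0"
      using x comm[of P] by (auto simp: zero)
    from det_nonzero_inverse[OF P(1) this]
    obtain Q where Q: "Q \<in> carrier_mat n n" "Q * P = 1\<^sub>m n" "P * Q = 1\<^sub>m n" .
    have "Q * A = Q * (A * (P * Q))"
      using A Q by simp
    also have "\<dots> = Q * (P * (A * Q))"
      using assoc_mult_mat[OF A P(1) Q(1)] assoc_mult_mat[OF P(1) A Q(1)] by (simp add: P(2))
    also have "\<dots> = A * Q"
      using assoc_mult_mat[OF Q(1) P(1), of "A * Q" n] A Q by simp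
    finally have "(Q, Q) \<in> carrier ?E"
      using Q hom by blast
    then show ?thesis
      using x Q unfolding Units_def P(3) by (auto simp: mult one intro!: bexI[of _ "(Q, Q)"])
  qed
  moreover have "\<zero>\<^bsub>?E\<^esub> \<notin> Units ?E"
    using nontrivial unfolding Units_def by force
  ultimately have units: "Units ?E = carrier ?E - {\<zero>\<^bsub>?E\<^esub>}"
    by (auto simp: Units_def)
  have assoc: "(c \<odot>\<^bsub>?E\<^esub> x) \<otimes>\<^bsub>?E\<^esub> y = c \<odot>\<^bsub>?E\<^esub> (x \<otimes>\<^bsub>?E\<^esub> y) \<and> x \<otimes>\<^bsub>?E\<^esub> (c \<odot>\<^bsub>?E\<^esub> y) = c \<odot>\<^bsub>?E\<^esub> (x \<otimes>\<^bsub>?E\<^esub> y)"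
    if "x \<in> carrier ?E" "y \<in> carrier ?E" for c x y
    using that unfolding hom
    by (auto simp: kronecker_End_def mult_smult_distrib)
  have "division_algebra (class_ring :: 'a ring) ?E"
    unfolding division_algebra_def
    using assoc nontrivial units kronecker_End_module[OF rep] E.ring_axioms class_field.field_axioms
    by blast
  then show ?thesis
    using rep dim \<open>n > 0\<close> by (auto simp: regular_simple_def)
qed

section \<open>Cyclic vectors\<close>

definition krylov :: "nat \<Rightarrow> 'a :: semiring_1 mat \<Rightarrow> 'a vec \<Rightarrow> 'a mat" where
  "krylov n A v = mat n n (\<lambda>(r, j). ((A ^\<^sub>m j) *\<^sub>v v) $ r)"

text \<open>
  A matrix \<open>P\<close> of the commutant that annihilates \<open>v\<close> annihilates each \<open>A\<^sup>j v\<close>, hence \<open>P * K = 0\<close> for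
  the Krylov matrix \<open>K\<close> of \<open>v\<close>; invertibility of \<open>K\<close> then gives \<open>P = 0\<close>.
\<close>

lemma commutant_det_nonzero:
  fixes A :: "'a :: field mat"
  assumes A: "A \<in> carrier_mat n n"
    and cyclic: "\<And>v. v \<in> carrier_vec n \<Longrightarrow> v \<noteq> 0\<^sub>v n \<Longrightarrow> det (krylov n A v) \<noteq> 0"
    and P: "P \<in> carrier_mat n n" "P * A = A * P" "P \<noteq> 0\<^sub>m n n"
  shows "det P \<noteq> 0"
proof
  assume "det P = 0"
  then obtain v where v: "v \<in> carrier_vec n" "v \<noteq> 0\<^sub>v n" "P *\<^sub>v v = 0\<^sub>v n"
    using det_0_iff_vec_prod_zero[OF P(1)] by blast
  have K: "krylov n A v \<in> carrier_mat n n"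
    by (simp add: krylov_def)
  have pow: "A ^\<^sub>m j \<in> carrier_mat n n" for j
    using A by simp
  have Apow: "P * A ^\<^sub>m j = A ^\<^sub>m j * P" for j
  proof (induction j)
    case (Suc j)
    then show ?case
      using assoc_mult_mat[OF P(1) pow A, of j] assoc_mult_mat[OF pow P(1) A, of j]
        assoc_mult_mat[OF pow A P(1), of j] P(2)
      by simp
  qed (use A P(1) in simp)
  have Apow0: "A ^\<^sub>m j *\<^sub>v 0\<^sub>v n = 0\<^sub>v n" for j
    using A by (intro eq_vecI) auto
  have "P *\<^sub>v (A ^\<^sub>m j *\<^sub>v v) = 0\<^sub>v n" for j
    using assoc_mult_mat_vec[OF P(1) pow v(1), of j] assoc_mult_mat_vec[OF pow P(1) v(1), of j]
    by (simp add: v(3) Apow Apow0)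
  moreover have "col (krylov n A v) j = A ^\<^sub>m j *\<^sub>v v" if "j < n" for j
    using that pow[of j] by (intro eq_vecI) (auto simp: krylov_def)
  ultimately have PK: "P * krylov n A v = 0\<^sub>m n n"
    using P(1) K by (intro mat_col_eqI) (auto simp: col_mult2[OF P(1) K] simp del: col_mult)
  obtain L where L: "L \<in> carrier_mat n n" "krylov n A v * L = 1\<^sub>m n"
    using det_nonzero_inverse[OF K cyclic[OF v(1,2)]] by metis
  have "P = P * krylov n A v * L"
    using P(1) K L by simp
  then show False
    using PK L P(3) by simp
qed

section \<open>Generic elements\<close>

lemma incl_0 [simp]: "incl n 0 = 0"
  by (simp add: incl_def)

lemma incl_1 [simp]: "n > 0 \<Longrightarrow> incl n 1 = 1"
  by (simp add: incl_def)

lemma incl_add: "incl n (x + y) = incl n x + incl n y"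
  by (simp add: incl_def)

lemma incl_mult: "incl n (x * y) = incl n x * incl n y"
  by (simp add: incl_def)

lemma incl_sum: "incl n (sum f S) = (\<Sum>i\<in>S. incl n (f i))"
  by (induction S rule: infinite_finite_induct) (auto simp: incl_add)

lemma incl_X: "n > 0 \<Longrightarrow> incl n fls_X = fls_X ^ n"
  by (simp add: incl_def fls_X_power_conv_shift_1)

lemma incl_eq_0_iff: "n > 0 \<Longrightarrow> incl n x = 0 \<longleftrightarrow> x = 0"
proof
  assume "n > 0" "incl n x = 0"
  then have "fls_nth (incl n x) (int n * m) = 0" for m
    by simp
  then show "x = 0"
    using \<open>n > 0\<close> by (intro fls_eqI) (simp add: incl_def fls_nth_compose_power)
qed simp

lemma sigma_0: "sigma n 0 = 0"
  by (intro fls_eqI) (simp add: sigma_nth)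

lemma sigma_power: "sigma n (a ^ j) = sigma n a ^ j"
  by (induction j) (auto simp: sigma_mult sigma_X_power[of n 0, simplified])

lemma sigma_sum: "sigma n (sum f S) = (\<Sum>i\<in>S. sigma n (f i))"
  by (induction S rule: infinite_finite_induct) (auto simp: sigma_add sigma_0)

text \<open>
  The automorphism \<open>sigma n\<close> fixes the image of k, so a relation with coefficients in k holds for
  all conjugates of \<open>a\<close> at once. It is a polynomial of degree less than \<open>n\<close> with \<open>n\<close> distinct
  roots.
\<close>

lemma generic_powers_independent:
  assumes n: "n > 0" and gen: "generic n a"
    and zero: "(\<Sum>j<n. incl n (c j) * a ^ j) = 0"
    and j: "j < n"
  shows "c j = 0"
proof -
  define p where "p = (\<Sum>i<n. Polynomial.monom (incl n (c i)) i)"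
  have conj: "(\<Sum>j<n. incl n (c j) * ((sigma n ^^ m) a) ^ j) = 0" for m
  proof (induction m)
    case (Suc m)
    then have "sigma n (\<Sum>j<n. incl n (c j) * ((sigma n ^^ m) a) ^ j) = 0"
      by (simp add: sigma_0)
    then show ?case
      using n by (simp add: sigma_sum sigma_mult sigma_power sigma_incl)
  qed (use zero in simp)
  have "poly p x = 0" if "x \<in> sigma_orbit n a" for x
    using that conj by (auto simp: sigma_orbit_def p_def poly_sum poly_monom)
  moreover have "degree p < n"
    unfolding p_def using n
    by (intro degree_sum_less) (auto intro: le_less_trans[OF degree_monom_le])
  ultimately have "p = 0"
    using gen n by (intro poly_eqI_degree[of "sigma_orbit n a"]) (auto simp: generic_def)
  then have "poly.coeff p j = 0"
    by simp
  then show ?thesis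
    using n j by (simp add: p_def coeff_sum incl_eq_0_iff)
qed

section \<open>Multiplication in the extension field as a matrix\<close>

text \<open>
  The basis vectors of k^n correspond to the powers of \<open>fls_X\<close> in decreasing order: \<open>alpha_gen n\<close>,
  acting on columns, sends each basis vector to the preceding one and the first to eps times the
  last, as multiplication by eps^{1/n} does with \<open>fls_X ^ (n - 1), \<dots>, fls_X, 1\<close>.
\<close>

definition element :: "nat \<Rightarrow> laurent vec \<Rightarrow> laurent" where
  "element n v = (\<Sum>i<n. incl n (v $ (n - 1 - i)) * fls_X ^ i)"

lemma element_eq_0_iff:
  assumes n: "n > 0" and v: "v \<in> carrier_vec n"
  shows "element n v = 0 \<longleftrightarrow> v = 0\<^sub>v n"
proof
  assume 0: "element n v = 0"
  have "v $ i = 0" if i: "i < n" for i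
  proof -
    have "coord n (n - 1 - i) 0 = v $ (n - 1 - (n - 1 - i))"
      using 0 n by (intro coord_unique) (auto simp: element_def)
    moreover have "coord n (n - 1 - i) 0 = 0"
      using n by (intro fls_eqI) (simp add: coord_nth)
    ultimately show ?thesis
      using i by simp
  qed
  then show "v = 0\<^sub>v n"
    using v by auto
qed (auto simp: element_def)

text \<open>
  This form of linearity only speaks of entries, which suits both uses: the entrywise definition of
  \<open>alpha\<close>, and the product of a Krylov matrix with a vector.
\<close>

lemma element_lincomb:
  fixes w :: "laurent vec" and u :: "'i \<Rightarrow> laurent vec"
  assumes "\<And>r. r < n \<Longrightarrow> w $ r = (\<Sum>j\<in>S. c j * u j $ r)"
  shows "element n w = (\<Sum>j\<in>S. incl n (c j) * element n (u j))"
proof -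
  have "element n w = (\<Sum>i<n. \<Sum>j\<in>S. incl n (c j) * (incl n (u j $ (n - 1 - i)) * fls_X ^ i))"
    unfolding element_def
    by (intro sum.cong) (auto simp: assms incl_sum incl_mult sum_distrib_left sum_distrib_right mult_ac)
  also have "\<dots> = (\<Sum>j\<in>S. incl n (c j) * element n (u j))"
    unfolding element_def by (subst sum.swap) (simp add: sum_distrib_left)
  finally show ?thesis .
qed

lemma alpha_gen_carrier [simp]: "alpha_gen n \<in> carrier_mat n n"
  by (simp add: alpha_gen_def)

lemma alpha_carrier [simp]: "alpha n a \<in> carrier_mat n n"
  by (simp add: alpha_def)

lemma element_alpha_gen:
  assumes n: "n > 0" and v: "v \<in> carrier_vec n"
  shows "element n (alpha_gen n *\<^sub>v v) = fls_X * element n v"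
proof -
  obtain m where m: "n = Suc m"
    using n by (cases n) auto
  have row: "(alpha_gen n *\<^sub>v v) $ i = (if i < m then v $ Suc i else fls_X * v $ 0)" if "i < n" for i
    using that v
    by (auto simp: m alpha_gen_def scalar_prod_def if_distrib[of "\<lambda>x. x * _"] sum.delta cong: if_cong)
  have "element n (alpha_gen n *\<^sub>v v) = incl n (fls_X * v $ 0) + (\<Sum>i<m. incl n (v $ (m - i)) * fls_X ^ Suc i)"
    unfolding element_def m
    by (subst sum.lessThan_Suc_shift) (auto simp: m row[unfolded m] Suc_diff_Suc intro!: sum.cong)
  \<comment> \<open>The entry eps in the last row contributes \<open>incl n fls_X\<close>, which is \<open>fls_X ^ n\<close>: the top term
    of the shifted sum.\<close>
  also have "\<dots> = (\<Sum>i<m. incl n (v $ (m - i)) * fls_X ^ Suc i) + incl n (v $ 0) * fls_X ^ Suc m"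
    using n by (simp add: incl_mult incl_X m)
  also have "\<dots> = fls_X * element n v"
    by (simp add: element_def m sum_distrib_left algebra_simps)
  finally show ?thesis .
qed

lemma element_power:
  assumes A: "A \<in> carrier_mat n n" and v: "v \<in> carrier_vec n"
    and act: "\<And>w. w \<in> carrier_vec n \<Longrightarrow> element n (A *\<^sub>v w) = b * element n w"
  shows "element n (A ^\<^sub>m j *\<^sub>v v) = b ^ j * element n v"
  using v
proof (induction j arbitrary: v)
  case (Suc j)
  have "A ^\<^sub>m Suc j *\<^sub>v v = A ^\<^sub>m j *\<^sub>v (A *\<^sub>v v)"
    using assoc_mult_mat_vec[OF pow_carrier_mat[OF A] A Suc.prems] by simp
  then show ?case
    using A Suc by (simp add: act mult_ac)
qed (use A in simp)

text \<open>
  By definition \<open>alpha n a\<close> is the polynomial in \<open>alpha_gen n\<close> whose value at \<open>fls_X\<close> is the expansion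
  of \<open>a\<close>, and \<open>alpha_gen n\<close> acts as multiplication by \<open>fls_X\<close>.
\<close>

lemma element_alpha:
  assumes n: "n > 0" and v: "v \<in> carrier_vec n"
  shows "element n (alpha n a *\<^sub>v v) = a * element n v"
proof -
  let ?g = "\<lambda>i. alpha_gen n ^\<^sub>m i"
  have g: "?g i \<in> carrier_mat n n" for i
    by simp
  have "(alpha n a *\<^sub>v v) $ r = (\<Sum>i<n. coord n i a * (?g i *\<^sub>v v) $ r)" if r: "r < n" for r
  proof -
    have "(alpha n a *\<^sub>v v) $ r = (\<Sum>s<n. \<Sum>i<n. coord n i a * (?g i $$ (r, s) * v $ s))"
      using r v carrier_matD[OF g]
      by (auto simp: alpha_def scalar_prod_def sum_distrib_left sum_distrib_right mult_ac
          atLeast0LessThan intro!: sum.cong)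
    also have "\<dots> = (\<Sum>i<n. \<Sum>s<n. coord n i a * (?g i $$ (r, s) * v $ s))"
      by (rule sum.swap)
    also have "\<dots> = (\<Sum>i<n. coord n i a * (?g i *\<^sub>v v) $ r)"
    proof (intro sum.cong refl)
      fix i
      have "(?g i *\<^sub>v v) $ r = (\<Sum>s<n. ?g i $$ (r, s) * v $ s)"
        using r v carrier_matD[OF g[of i]]
        by (auto simp: scalar_prod_def atLeast0LessThan intro!: sum.cong)
      then show "(\<Sum>s<n. coord n i a * (?g i $$ (r, s) * v $ s)) = coord n i a * (?g i *\<^sub>v v) $ r"
        by (simp add: sum_distrib_left)
    qed
    finally show ?thesis .
  qed
  then have "element n (alpha n a *\<^sub>v v) = (\<Sum>i<n. incl n (coord n i a) * element n (?g i *\<^sub>v v))"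
    by (rule element_lincomb)
  also have "\<dots> = (\<Sum>i<n. incl n (coord n i a) * fls_X ^ i) * element n v"
    using element_power[OF alpha_gen_carrier v element_alpha_gen[OF n]]
    by (simp add: sum_distrib_left sum_distrib_right mult_ac)
  also have "\<dots> = a * element n v"
    using coord_expansion[OF n, of a] by simp
  finally show ?thesis .
qed

text \<open>
  The coefficients of a relation between the columns of the Krylov matrix are those of a relation
  between the first \<open>n\<close> powers of \<open>a\<close>, since \<open>element n v\<close> is nonzero and k_n is a field.
\<close>

lemma alpha_generic_cyclic:
  assumes n: "n > 0" and gen: "generic n a" and v: "v \<in> carrier_vec n" "v \<noteq> 0\<^sub>v n"
  shows "det (krylov n (alpha n a) v) \<noteq> 0"
proof
  let ?A = "alpha n a"
  have K: "krylov n ?A v \<in> carrier_mat n n"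
    by (simp add: krylov_def)
  assume "det (krylov n ?A v) = 0"
  then obtain c where c: "c \<in> carrier_vec n" "c \<noteq> 0\<^sub>v n" "krylov n ?A v *\<^sub>v c = 0\<^sub>v n"
    using det_0_iff_vec_prod_zero[OF K] by blast
  have "(krylov n ?A v *\<^sub>v c) $ r = (\<Sum>j<n. c $ j * (?A ^\<^sub>m j *\<^sub>v v) $ r)" if "r < n" for r
    using that c(1)
    by (auto simp: krylov_def scalar_prod_def atLeast0LessThan mult_ac intro!: sum.cong)
  then have "element n (krylov n ?A v *\<^sub>v c) = (\<Sum>j<n. incl n (c $ j) * element n (?A ^\<^sub>m j *\<^sub>v v))"
    by (rule element_lincomb)
  also have "\<dots> = (\<Sum>j<n. incl n (c $ j) * a ^ j) * element n v"
    using element_power[OF alpha_carrier v(1) element_alpha[OF n]]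
    by (simp add: sum_distrib_left sum_distrib_right mult_ac)
  finally have "(\<Sum>j<n. incl n (c $ j) * a ^ j) = 0"
    using c(3) element_eq_0_iff[OF n v(1)] element_eq_0_iff[OF n zero_carrier_vec] v(2) by simp
  then have "c $ j = 0" if "j < n" for j
    using generic_powers_independent[OF n gen] that by blast
  then show False
    using c(1,2) by auto
qed

theorem theorem3p29:
  fixes n :: nat and a :: laurent
  assumes "n > 0" and "generic n a"
  shows "regular_simple (phi n a)"
  unfolding phi_def
proof (rule regular_simple_commutant[OF alpha_carrier assms(1)])
  fix P
  assume "P \<in> carrier_mat n n" "P * alpha n a = alpha n a * P" "P \<noteq> 0\<^sub>m n n"
  then show "det P \<noteq> 0"
    using commutant_det_nonzero[OF alpha_carrier alpha_generic_cyclic[OF assms]] by blast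
qed

end
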